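(* For each positive integer $k$ there exists a constant $c=c(k)$ such that for every integer $r\geq c(k)$ and all sufficiently large $n$, $$ex_\phi(n,K_{r+1})=e_\phi(T_r(n)),$$ where $c(k)=1+\lim_{n\to\infty}(n/c_1)$, and $c_1$, with $0\leq c_1\leq n-k$, is the root of the function $x\mapsto 1-x\Psi(n-x+1)+x\Psi(n-x-k+1)$, $\Psi$ denoting the Digamma function.
   Context: All graphs are finite, simple and undirected. For a positive integer $k$ and a graph $G$ with degree sequence $d_1,\ldots,d_n$, define $e_\phi(G)=\sum_{i=1}^n\binom{d_i}{k}$. For a graph $H$, $ex_\phi(n,H)$ denotes the maximum of $e_\phi(G)$ over all graphs $G$ on $n$ vertices that do not contain $H$ as a subgraph. $K_{r+1}$ is the complete graph on $r+1$ vertices, and $T_r(n)$ is the complete $r$-partite graph on $n$ vertices whose part sizes differ by at most one. The Digamma function is $\Psi(x)=\Gamma'(x)/\Gamma(x)$. Throughout, $k\leq n/2$ is assumed. *)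

theory Defs
  imports "HOL-Analysis.Analysis" "Graph_Theory.Graph_Theory"
begin

text \<open>
  A finite simple undirected graph is a \<^locale>\<open>pair_graph\<close>: a finite vertex set with a
  symmetric irreflexive set of arcs, so that the degree of a vertex is its \<^const>\<open>out_degree\<close>.
\<close>

definition e_phi :: "nat \<Rightarrow> 'a pair_pre_digraph \<Rightarrow> nat" where
  "e_phi k G = (\<Sum>v\<in>pverts G. out_degree (with_proj G) v choose k)"

definition contains_subgraph :: "'a pair_pre_digraph \<Rightarrow> 'b pair_pre_digraph \<Rightarrow> bool" where
  "contains_subgraph G H \<longleftrightarrow>
     (\<exists>S. subgraph (with_proj S) (with_proj G) \<and> digraph_iso (with_proj H) (with_proj S))"

definition H_free_graphs :: "nat \<Rightarrow> 'b pair_pre_digraph \<Rightarrow> nat pair_pre_digraph set" where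
  "H_free_graphs n H = {G. pair_graph G \<and> card (pverts G) = n \<and> \<not> contains_subgraph G H}"

text \<open>
  Vertices are natural numbers, which is no restriction up to isomorphism. The maximum is that
  of a finite set (\<open>finite_e_phi_H_free\<close>), which is nonempty in the case of interest
  (\<open>H_free_complete_nonempty\<close>).
\<close>

definition ex_phi :: "nat \<Rightarrow> nat \<Rightarrow> 'b pair_pre_digraph \<Rightarrow> nat" where
  "ex_phi k n H = Max (e_phi k ` H_free_graphs n H)"

definition complete_graph :: "nat \<Rightarrow> nat pair_pre_digraph" where
  "complete_graph m = \<lparr>pverts = {..<m}, parcs = {(u, v). u < m \<and> v < m \<and> u \<noteq> v}\<rparr>"

text \<open>
  The Turan graph; its parts are the residue classes modulo \<open>r\<close> (meaningful for \<open>r \<ge> 1\<close>),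
  whose sizes differ by at most one by \<open>turan_parts_balanced\<close>. Some parts are empty if \<open>n < r\<close>.
\<close>

definition turan_part :: "nat \<Rightarrow> nat \<Rightarrow> nat \<Rightarrow> nat set" where
  "turan_part r n i = {v. v < n \<and> v mod r = i}"

definition turan_graph :: "nat \<Rightarrow> nat \<Rightarrow> nat pair_pre_digraph" where
  "turan_graph r n =
     \<lparr>pverts = {..<n},
      parcs = {(u, v). \<exists>i<r. \<exists>j<r. i \<noteq> j \<and> u \<in> turan_part r n i \<and> v \<in> turan_part r n j}\<rparr>"

definition is_c1 :: "nat \<Rightarrow> nat \<Rightarrow> real \<Rightarrow> bool" where
  "is_c1 k n x \<longleftrightarrow> 0 \<le> x \<and> x \<le> real n - real k \<and>
     1 - x * Digamma (real n - x + 1) + x * Digamma (real n - x - real k + 1) = 0"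

definition c1 :: "nat \<Rightarrow> nat \<Rightarrow> real" where
  "c1 k n = (THE x. is_c1 k n x)"


lemma complete_graph_complete: "complete_digraph m (with_proj (complete_graph m))"
  by (auto simp: complete_digraph_pair_def complete_graph_def)

lemma pair_graph_turan_graph: "pair_graph (turan_graph r n)"
proof -
  have "parcs (turan_graph r n) \<subseteq> {..<n} \<times> {..<n}"
    by (auto simp: turan_graph_def turan_part_def)
  then have "finite (parcs (turan_graph r n))"
    by (rule finite_subset) simp
  then show ?thesis
    by unfold_locales
      (auto simp: turan_graph_def turan_part_def symmetric_def sym_def)
qed

lemma turan_parts_partition:
  assumes "r \<ge> 1"
  shows "(\<Union>i<r. turan_part r n i) = pverts (turan_graph r n)"
    and "disjoint_family_on (turan_part r n) {..<r}"
  using assms by (auto simp: turan_part_def turan_graph_def disjoint_family_on_def)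

lemma card_turan_part:
  assumes "i < r"
  shows "card (turan_part r n i) = n div r + (if i < n mod r then 1 else 0)"
proof (induction n)
  case 0
  then show ?case by (simp add: turan_part_def)
next
  case (Suc n)
  have fin: "finite (turan_part r n i)" and notin: "n \<notin> turan_part r n i"
    by (auto simp: turan_part_def)
  have step: "turan_part r (Suc n) i =
      (if n mod r = i then insert n (turan_part r n i) else turan_part r n i)"
    by (auto simp: turan_part_def less_Suc_eq)
  show ?case
    using Suc.IH fin notin assms mod_less_divisor[of r n]
    by (auto simp: step mod_Suc div_Suc)
qed

lemma turan_parts_balanced:
  assumes "i < r" "j < r"
  shows "card (turan_part r n i) \<le> card (turan_part r n j) + 1"
  using assms by (simp add: card_turan_part)

lemma finite_e_phi_H_free: "finite (e_phi k ` H_free_graphs n H)"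
proof -
  have "e_phi k G \<le> n * (n choose k)" if G: "G \<in> H_free_graphs n H" for G
  proof -
    from G have pg: "pair_graph G" and card: "card (pverts G) = n"
      by (auto simp: H_free_graphs_def)
    interpret pair_graph G by (rule pg)
    have "out_degree (with_proj G) v \<le> n" for v
    proof -
      have "out_arcs (with_proj G) v \<subseteq> Pair v ` pverts G"
        by (auto simp: out_arcs_def dest: in_arcsD2)
      then have "card (out_arcs (with_proj G) v) \<le> card (pverts G)"
        using pair_finite_verts by (meson surj_card_le)
      then show ?thesis by (simp add: out_degree_def card)
    qed
    then have "e_phi k G \<le> (\<Sum>v\<in>pverts G. n choose k)"
      unfolding e_phi_def by (intro sum_mono binomial_right_mono)
    then show ?thesis by (simp add: card)
  qed
  then have "e_phi k ` H_free_graphs n H \<subseteq> {..n * (n choose k)}" by auto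
  then show ?thesis by (rule finite_subset) simp
qed

lemma H_free_complete_nonempty:
  assumes "m \<ge> 2"
  shows "H_free_graphs n (complete_graph m) \<noteq> {}"
proof -
  let ?G = "\<lparr>pverts = {..<n}, parcs = {}\<rparr>"
  have "pair_graph ?G"
    by unfold_locales (auto simp: symmetric_def)
  moreover have "\<not> contains_subgraph ?G (complete_graph m)"
  proof
    assume "contains_subgraph ?G (complete_graph m)"
    then obtain S where S: "subgraph (with_proj S) (with_proj ?G)"
      "digraph_iso (with_proj (complete_graph m)) (with_proj S)"
      unfolding contains_subgraph_def by auto
    from S(1) have "arcs (with_proj S) = {}" by (auto simp: subgraph_def)
    with S(2) have "parcs (complete_graph m) = {}"
      by (auto simp: digraph_iso_def app_iso_def with_proj_def)
    moreover have "(0, 1) \<in> parcs (complete_graph m)"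
      using assms by (simp add: complete_graph_def)
    ultimately show False by simp
  qed
  ultimately have "?G \<in> H_free_graphs n (complete_graph m)"
    by (simp add: H_free_graphs_def)
  then show ?thesis by blast
qed

end

theory Submission
  imports Defs "HOL-Real_Asymp.Real_Asymp"
begin

text \<open>
  Let \<open>v\<close> have maximum degree in a \<open>K\<^bsub>r+1\<^esub>\<close>-free graph. Making the non-neighbours of \<open>v\<close> one
  independent part joined to everything else, and recursing into the \<open>K\<^sub>r\<close>-free neighbourhood of \<open>v\<close>,
  does not decrease the sum of any monotone function of the degrees; so complete \<open>r\<close>-partite graphs
  are optimal, and it remains to maximise \<open>\<Sum>g(x\<^sub>i)\<close> for \<open>g(x) = x ((n - x) choose k)\<close> and
  \<open>\<Sum>x\<^sub>i = n\<close>. The function \<open>g\<close> lies below its chord through \<open>q\<close> and \<open>q + 1\<close> for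
  \<open>q = n div r\<close>, and the chord is exact on balanced part sizes.

  By the functional equation of the Digamma function, \<open>c\<^sub>1\<close> is the solution of
  \<open>x (\<Sum>i<k. 1 / (n - x - k + 1 + i)) = 1\<close>, which lies between \<open>(n - k + 1) / (k + 1)\<close> and
  \<open>n / (k + 1)\<close>; so \<open>n / c\<^sub>1\<close> tends to \<open>k + 1\<close> and the threshold is \<open>k + 2\<close>.
\<close>

section \<open>Degree sums of graphs without large cliques\<close>

text \<open>Induction on \<open>r\<close> with \<open>\<phi>\<close> left arbitrary: inside the
  neighbourhood \<open>N\<close> of \<open>v\<close> the joined part adds \<open>m\<close> to every
  degree, so the recursion needs the shifted function
  \<open>\<lambda>t. \<phi> (t + m)\<close>.\<close>

lemma degree_sum_le_multipartite:
  fixes \<phi> :: "nat \<Rightarrow> nat"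
  assumes "finite V" "sym E" "irrefl E" "mono \<phi>"
    and "\<forall>S\<subseteq>V. card S = Suc r \<longrightarrow> (\<exists>u\<in>S. \<exists>v\<in>S. u \<noteq> v \<and> (u, v) \<notin> E)"
  shows "\<exists>x. (\<Sum>i<r. x i) = card V \<and>
           (\<Sum>u\<in>V. \<phi> (card (V \<inter> E `` {u}))) \<le> (\<Sum>i<r. x i * \<phi> (card V - x i))"
  using assms(1,4,5)
proof (induction r arbitrary: V \<phi>)
  case 0
  have "V = {}"
  proof (rule ccontr)
    assume "V \<noteq> {}"
    then obtain u where "u \<in> V" by blast
    then have "\<exists>a\<in>{u}. \<exists>b\<in>{u}. a \<noteq> b \<and> (a, b) \<notin> E"
      using "0.prems"(3) by (metis card.empty card.insert empty_iff empty_subsetI finite.emptyI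
          insert_subset)
    then show False by blast
  qed
  then show ?case by simp
next
  case (Suc r)
  note fin = Suc.prems(1) and mono = Suc.prems(2) and clique = Suc.prems(3)
  show ?case
  proof (cases "V = {}")
    case True
    then show ?thesis by (intro exI[of _ "\<lambda>_. 0"]) simp
  next
    case False
    define d where "d u = card (V \<inter> E `` {u})" for u
    obtain v where v: "v \<in> V" "\<And>u. u \<in> V \<Longrightarrow> d u \<le> d v"
    proof -
      have "Max (d ` V) \<in> d ` V" using False fin by simp
      then obtain v where "v \<in> V" "d v = Max (d ` V)" by auto
      then show ?thesis using fin by (intro that[of v]) auto
    qed
    define N where "N = V \<inter> E `` {v}"
    define m where "m = card (V - N)"
    have NV: "N \<subseteq> V" and finN: "finite N" and dv: "d v = card N"
      using fin by (auto simp: N_def d_def)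
    have card_V: "card V = card N + m"
      using NV fin unfolding m_def by (metis card_Diff_subset card_mono finN le_add_diff_inverse)
    \<comment> \<open>A clique of \<open>Suc r\<close> vertices in \<open>N\<close> would extend by
      \<open>v\<close>.\<close>
    have clique_N: "\<forall>S\<subseteq>N. card S = Suc r \<longrightarrow> (\<exists>u\<in>S. \<exists>w\<in>S. u \<noteq> w \<and> (u, w) \<notin> E)"
    proof (intro allI impI)
      fix S assume S: "S \<subseteq> N" "card S = Suc r"
      have "v \<notin> S" using S assms(3) by (auto simp: N_def irrefl_def)
      moreover have "finite S" using S finN finite_subset by blast
      ultimately have "card (insert v S) = Suc (Suc r)" using S by simp
      moreover have "insert v S \<subseteq> V" using S NV v by auto
      ultimately obtain u w where uw: "u \<in> insert v S" "w \<in> insert v S" "u \<noteq> w" "(u, w) \<notin> E"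
        using clique by meson
      have "(v, s) \<in> E \<and> (s, v) \<in> E" if "s \<in> S" for s
        using that S(1) assms(2) by (auto simp: N_def dest: symD)
      then show "\<exists>u\<in>S. \<exists>w\<in>S. u \<noteq> w \<and> (u, w) \<notin> E" using uw by auto
    qed
    have "mono (\<lambda>t. \<phi> (t + m))" using mono by (auto simp: mono_def)
    from Suc.IH[OF finN this clique_N] obtain x where x: "(\<Sum>i<r. x i) = card N"
      "(\<Sum>u\<in>N. \<phi> (card (N \<inter> E `` {u}) + m)) \<le> (\<Sum>i<r. x i * \<phi> (card N - x i + m))"
      by blast
    let ?x = "x(r := m)"
    have "(\<Sum>u\<in>V. \<phi> (d u)) = (\<Sum>u\<in>N. \<phi> (d u)) + (\<Sum>u\<in>V - N. \<phi> (d u))"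
      using sum.subset_diff[OF NV fin] by (simp add: add.commute)
    \<comment> \<open>Vertices outside \<open>N\<close>, including \<open>v\<close>, have degree at
      most \<open>d v = card N\<close>, which is exactly their degree as a part of size
      \<open>m\<close>.\<close>
    also have "(\<Sum>u\<in>V - N. \<phi> (d u)) \<le> (\<Sum>u\<in>V - N. \<phi> (card N))"
      using v(2) mono by (intro sum_mono) (auto simp: mono_def dv)
    also have "\<dots> = m * \<phi> (card N)" by (simp add: m_def)
    also have "(\<Sum>u\<in>N. \<phi> (d u)) \<le> (\<Sum>u\<in>N. \<phi> (card (N \<inter> E `` {u}) + m))"
    proof (intro sum_mono monoD[OF mono])
      fix u
      \<comment> \<open>At most \<open>m\<close> neighbours lie outside \<open>N\<close>, as many as
        the new part supplies.\<close>
      have "V \<inter> E `` {u} \<subseteq> (N \<inter> E `` {u}) \<union> (V - N)" by auto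
      then have "d u \<le> card ((N \<inter> E `` {u}) \<union> (V - N))"
        unfolding d_def using fin finN by (intro card_mono) auto
      also have "\<dots> \<le> card (N \<inter> E `` {u}) + m" unfolding m_def by (rule card_Un_le)
      finally show "d u \<le> card (N \<inter> E `` {u}) + m" .
    qed
    also note x(2)
    also have "(\<Sum>i<r. x i * \<phi> (card N - x i + m)) = (\<Sum>i<r. ?x i * \<phi> (card V - ?x i))"
    proof (intro sum.cong refl)
      fix i assume i: "i \<in> {..<r}"
      have "x i \<le> (\<Sum>i<r. x i)" using i by (intro member_le_sum) auto
      then show "x i * \<phi> (card N - x i + m) = ?x i * \<phi> (card V - ?x i)"
        using i x(1) card_V by simp
    qed
    finally have "(\<Sum>u\<in>V. \<phi> (d u)) \<le> (\<Sum>i<Suc r. ?x i * \<phi> (card V - ?x i))"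
      by (simp add: card_V)
    moreover have "(\<Sum>i<Suc r. ?x i) = card V" using x(1) card_V by simp
    ultimately show ?thesis unfolding d_def by blast
  qed
qed

text \<open>Replaces digraph isomorphisms by cliques as vertex sets, the form used by the degree
  argument.\<close>

lemma contains_complete_graph_iff:
  assumes "pair_graph G"
  shows "contains_subgraph G (complete_graph m) \<longleftrightarrow>
    (\<exists>S\<subseteq>pverts G. card S = m \<and> (\<forall>u\<in>S. \<forall>v\<in>S. u \<noteq> v \<longrightarrow> (u, v) \<in> parcs G))"
    (is "?L \<longleftrightarrow> ?R")
proof -
  interpret G: pair_graph G by (rule assms)
  have wfK: "wf_digraph (with_proj (complete_graph m))"
    by unfold_locales (auto simp: complete_graph_def)
  show ?thesis
  proof
    assume ?L
    then obtain S f where S: "subgraph (with_proj S) (with_proj G)"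
      and f: "pre_digraph.digraph_isomorphism (with_proj (complete_graph m)) f"
      and eq: "with_proj S = app_iso f (with_proj (complete_graph m))"
      unfolding contains_subgraph_def digraph_iso_def by blast
    let ?h = "iso_verts f"
    \<comment> \<open>Both sides of \<open>eq\<close> are compared by component. The tail and head
      of \<open>with_proj S\<close> are projections, so \<open>iso_arcs f\<close> must act on an arc
      by applying \<open>?h\<close> to both endpoints.\<close>
    from arg_cong[OF eq, of verts] arg_cong[OF eq, of arcs] arg_cong[OF eq, of tail]
      arg_cong[OF eq, of head]
    have eqs: "pverts S = ?h ` {..<m}" "parcs S = iso_arcs f ` parcs (complete_graph m)"
      "iso_tail f = fst" "iso_head f = snd"
      by (simp_all add: complete_graph_def)
    have inj: "inj_on ?h {..<m}"
      using f by (simp add: pre_digraph.digraph_isomorphism_def complete_graph_def)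
    have arc: "(?h u, ?h v) \<in> parcs G" if "u < m" "v < m" "u \<noteq> v" for u v
    proof -
      have K: "(u, v) \<in> parcs (complete_graph m)" using that by (simp add: complete_graph_def)
      then have "iso_arcs f (u, v) = (?h u, ?h v)"
        using f eqs(3,4) by (auto simp: pre_digraph.digraph_isomorphism_def prod_eq_iff)
      then have "(?h u, ?h v) \<in> parcs S" using K eqs(2) by (metis imageI)
      then show ?thesis using S by (auto simp: subgraph_def)
    qed
    have "pverts S \<subseteq> pverts G" using S by (auto simp: subgraph_def)
    then show ?R using inj arc eqs(1)
      by (intro exI[of _ "pverts S"]) (auto simp: card_image)
  next
    assume ?R
    then obtain S where S: "S \<subseteq> pverts G" "card S = m"
      "\<And>u v. u \<in> S \<Longrightarrow> v \<in> S \<Longrightarrow> u \<noteq> v \<Longrightarrow> (u, v) \<in> parcs G" by blast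
    have "finite S" using S(1) G.pair_finite_verts finite_subset by blast
    then obtain h where h: "bij_betw h {..<m} S"
      using ex_bij_betw_nat_finite[of S] S(2) by (auto simp: atLeast0LessThan)
    then have inj: "inj_on h {..<m}" and img: "h ` {..<m} = S" by (auto simp: bij_betw_def)
    let ?S = "\<lparr>pverts = S, parcs = {(u, v). u \<in> S \<and> v \<in> S \<and> u \<noteq> v}\<rparr>"
    let ?f = "\<lparr>iso_verts = h, iso_arcs = map_prod h h, iso_head = snd, iso_tail = fst\<rparr>"
    have sub: "subgraph (with_proj ?S) (with_proj G)"
      unfolding subgraph_def
    proof (intro conjI)
      show "wf_digraph (with_proj G)" by unfold_locales
      show "wf_digraph (with_proj ?S)" by unfold_locales auto
    qed (use S in \<open>auto simp: compatible_def\<close>)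
    have "inj_on (map_prod h h) (parcs (complete_graph m))"
      using inj by (auto simp: inj_on_def complete_graph_def)
    then have iso: "pre_digraph.digraph_isomorphism (with_proj (complete_graph m)) ?f"
      using wfK inj by (auto simp: pre_digraph.digraph_isomorphism_def complete_graph_def)
    have "map_prod h h ` parcs (complete_graph m) = parcs ?S"
    proof
      show "map_prod h h ` parcs (complete_graph m) \<subseteq> parcs ?S"
        using inj img by (auto simp: complete_graph_def dest: inj_onD)
      show "parcs ?S \<subseteq> map_prod h h ` parcs (complete_graph m)"
      proof clarsimp
        fix a b assume "a \<in> S" "b \<in> S" "a \<noteq> b"
        then obtain u v where "u < m" "v < m" "a = h u" "b = h v" using img by blast
        then show "(a, b) \<in> map_prod h h ` parcs (complete_graph m)"
          using \<open>a \<noteq> b\<close> by (intro image_eqI[of _ _ "(u, v)"]) (auto simp: complete_graph_def)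
      qed
    qed
    then have "with_proj ?S = app_iso ?f (with_proj (complete_graph m))"
      using img by (simp add: with_proj_def app_iso_def complete_graph_def)
    then show ?L using sub iso unfolding contains_subgraph_def digraph_iso_def by blast
  qed
qed

lemma (in pair_wf_digraph) out_degree_eq_card_Image:
  "out_degree (with_proj G) v = card (pverts G \<inter> parcs G `` {v})"
proof -
  have "out_arcs (with_proj G) v = Pair v ` (pverts G \<inter> parcs G `` {v})"
    by (auto simp: out_arcs_def dest: in_arcsD2)
  then show ?thesis by (simp add: out_degree_def card_image inj_on_def)
qed

lemma e_phi_le_multipartite:
  assumes "G \<in> H_free_graphs n (complete_graph (r + 1))"
  shows "\<exists>x. (\<Sum>i<r. x i) = n \<and> e_phi k G \<le> (\<Sum>i<r. x i * ((n - x i) choose k))"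
proof -
  have pg: "pair_graph G" and card: "card (pverts G) = n"
    and free: "\<not> contains_subgraph G (complete_graph (r + 1))"
    using assms by (auto simp: H_free_graphs_def)
  interpret pair_graph G by (rule pg)
  have sym: "sym (parcs G)" using arcs_symmetric by (auto intro: symI)
  have irr: "irrefl (parcs G)" using no_loops' by (auto simp: irrefl_def)
  have mono: "mono (\<lambda>d. d choose k)" by (simp add: mono_def binomial_right_mono)
  have "\<forall>S\<subseteq>pverts G. card S = Suc r \<longrightarrow> (\<exists>u\<in>S. \<exists>v\<in>S. u \<noteq> v \<and> (u, v) \<notin> parcs G)"
    using free contains_complete_graph_iff[OF pg, of "r + 1"] by auto
  from degree_sum_le_multipartite[OF pair_finite_verts sym irr mono this] show ?thesis
    by (simp add: e_phi_def out_degree_eq_card_Image card)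
qed

section \<open>The Turan graph\<close>

text \<open>Pigeonhole: the vertices of a clique have distinct residues modulo
  \<open>r\<close>.\<close>

lemma turan_graph_in_H_free_graphs:
  assumes "r \<ge> 1"
  shows "turan_graph r n \<in> H_free_graphs n (complete_graph (r + 1))"
proof -
  have "\<not> contains_subgraph (turan_graph r n) (complete_graph (r + 1))"
  proof
    assume "contains_subgraph (turan_graph r n) (complete_graph (r + 1))"
    then obtain S where S: "card S = r + 1"
      "\<And>u v. u \<in> S \<Longrightarrow> v \<in> S \<Longrightarrow> u \<noteq> v \<Longrightarrow> (u, v) \<in> parcs (turan_graph r n)"
      by (auto simp: contains_complete_graph_iff[OF pair_graph_turan_graph])
    have arc: "u mod r \<noteq> v mod r" if "u \<in> S" "v \<in> S" "u \<noteq> v" for u v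
      using S(2)[OF that] by (auto simp: turan_graph_def turan_part_def)
    have "inj_on (\<lambda>u. u mod r) S" using arc by (auto simp: inj_on_def)
    then have "card S \<le> card {..<r}" using assms by (intro card_inj_on_le) auto
    then show False using S(1) by simp
  qed
  then show ?thesis using pair_graph_turan_graph
    by (simp add: H_free_graphs_def) (simp add: turan_graph_def)
qed

lemma e_phi_turan_graph:
  assumes "r \<ge> 1"
  shows "e_phi k (turan_graph r n) =
    (\<Sum>i<r. card (turan_part r n i) * ((n - card (turan_part r n i)) choose k))"
proof -
  let ?T = "turan_graph r n" and ?P = "turan_part r n"
  interpret T: pair_graph ?T by (rule pair_graph_turan_graph)
  have fin: "finite (?P i)" for i by (auto simp: turan_part_def)
  have deg: "out_degree (with_proj ?T) v = n - card (?P i)" if "i < r" "v \<in> ?P i" for i v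
  proof -
    have "pverts ?T \<inter> parcs ?T `` {v} = {..<n} - ?P i"
      using that assms by (auto simp: turan_graph_def turan_part_def)
    moreover have "?P i \<subseteq> {..<n}" by (auto simp: turan_part_def)
    ultimately show ?thesis by (simp add: T.out_degree_eq_card_Image card_Diff_subset fin)
  qed
  have "e_phi k ?T = (\<Sum>v\<in>(\<Union>i<r. ?P i). out_degree (with_proj ?T) v choose k)"
    by (simp add: e_phi_def turan_parts_partition(1)[OF assms])
  also have "\<dots> = (\<Sum>i<r. \<Sum>v\<in>?P i. out_degree (with_proj ?T) v choose k)"
    using turan_parts_partition(2)[OF assms, of n] fin
    by (intro sum.UNION_disjoint) (auto simp: disjoint_family_on_def)
  also have "\<dots> = (\<Sum>i<r. card (?P i) * ((n - card (?P i)) choose k))"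
    by (intro sum.cong refl) (simp add: deg)
  finally show ?thesis .
qed

section \<open>Optimal part sizes\<close>

text \<open>Multiplying by \<open>k\<close> and absorbing it into the binomial splits the increment
  of \<open>g\<close> into a nonnegative nonincreasing factor and one linear in \<open>x\<close>,
  which alone decides the sign. Real arithmetic avoids truncated differences.\<close>

lemma part_contribution_diff:
  fixes n k x :: nat
  assumes "k \<ge> 1" "x < n"
  defines "g \<equiv> \<lambda>x. real x * real ((n - x) choose k)"
  shows "real k * (g (Suc x) - g x) =
    real ((n - Suc x) choose (k - 1)) * (real n - real k - (real k + 1) * real x)"
proof -
  obtain j where k: "k = Suc j" using assms(1) by (cases k) auto
  define m where "m = n - Suc x"
  have n: "n = m + Suc x" using assms(2) by (simp add: m_def)
  \<comment> \<open>For \<open>m < j\<close> both binomials vanish, so the negative factor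
    \<open>real m - real j\<close> does no harm.\<close>
  have absorb: "real (Suc j) * real (m choose Suc j) = (real m - real j) * real (m choose j)"
  proof (cases "j \<le> m")
    case True
    have "Suc j * (m choose Suc j) = (m - j) * (m choose j)"
      using Suc_times_binomial_eq[of m j] by (simp add: algebra_simps diff_mult_distrib)
    then show ?thesis using True by (metis of_nat_diff of_nat_mult)
  qed (simp add: binomial_eq_0)
  have "n - x = Suc m" "n - Suc x = m" using n by auto
  then have "real k * (g (Suc x) - g x) =
      real (Suc j) * real (m choose Suc j) - real (Suc j) * real x * real (m choose j)"
    unfolding g_def k by (simp add: algebra_simps)
  also have "\<dots> = real (m choose j) * (real m - real j - real (Suc j) * real x)"
    unfolding absorb by (simp add: algebra_simps)
  finally show ?thesis by (simp add: n k algebra_simps)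
qed

text \<open>
  The increments of \<open>g\<close> decrease as long as they are nonnegative and stay nonpositive afterwards.
  Hence the chord through \<open>q\<close> and \<open>q + 1\<close> lies above \<open>g\<close> on all of \<open>{0..n}\<close>, although \<open>g\<close> is
  not concave there.
\<close>

lemma part_contribution_le_chord:
  fixes n k q x :: nat
  assumes "k \<ge> 1" "q < n" "(k + 1) * q + k \<le> n" "x \<le> n"
  defines "g \<equiv> \<lambda>x. real x * real ((n - x) choose k)"
  shows "g x \<le> g q + (real x - real q) * (g (Suc q) - g q)"
proof -
  define h where "h x = real n - real k - (real k + 1) * real x" for x :: nat
  define b where "b x = real ((n - Suc x) choose (k - 1))" for x
  have diff: "real k * (g (Suc x) - g x) = b x * h x" if "x < n" for x
    using part_contribution_diff[OF assms(1) that] unfolding g_def b_def h_def .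
  have b: "b y \<le> b x" "0 \<le> b x" if "x \<le> y" for x y
    unfolding b_def using that by (auto intro!: binomial_right_mono)
  have h: "h y \<le> h x" if "x \<le> y" for x y
    unfolding h_def using that by (simp add: mult_left_mono)
  \<comment> \<open>The hypothesis on \<open>q\<close> says precisely that the linear factor at
    \<open>q\<close> is nonnegative.\<close>
  have "real ((k + 1) * q + k) \<le> real n" using assms(3) by (rule of_nat_mono)
  then have hq: "0 \<le> h q" unfolding h_def by (simp add: algebra_simps)
  have up: "g (Suc y) - g y \<le> g (Suc q) - g q" if "q \<le> y" "y < n" for y
  proof -
    have "b y * h y \<le> b q * h q"
    \<comment> \<open>Once \<open>h y\<close> is negative the product need not be monotone, but its
      sign is enough against the nonnegative value at \<open>q\<close>.\<close>
    proof (cases "0 \<le> h y")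
      case True
      then show ?thesis using b[OF that(1)] b(2)[of y y] h[OF that(1)] by (intro mult_mono) auto
    next
      case False
      then have "b y * h y \<le> 0" using b(2)[of y y] by (simp add: mult_nonneg_nonpos)
      also have "0 \<le> b q * h q" using b(2)[of q q] hq by simp
      finally show ?thesis .
    qed
    then show ?thesis using diff[of y] diff[of q] that assms(1,2)
      by (metis mult_le_cancel_left_pos of_nat_0_less_iff less_le_trans zero_less_one)
  qed
  have down: "g (Suc q) - g q \<le> g (Suc y) - g y" if "y \<le> q" for y
  proof -
    have "b q * h q \<le> b y * h y"
      using b[OF that] h[OF that] hq b(2)[of y y] by (intro mult_mono) auto
    then show ?thesis using diff[of y] diff[of q] that assms(1,2)
      by (metis mult_le_cancel_left_pos of_nat_0_less_iff less_le_trans zero_less_one le_less_trans)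
  qed
  \<comment> \<open>The increments are summed from \<open>q\<close> upwards or downwards to
    \<open>x\<close>.\<close>
  show ?thesis
  proof (cases "q \<le> x")
    case True
    from this assms(4) show ?thesis
    proof (induction x rule: dec_induct)
      case (step y)
      with up[of y] show ?case by (simp add: algebra_simps)
    qed simp
  next
    case False
    then have "x \<le> q" by simp
    then show ?thesis
    proof (induction x rule: inc_induct)
      case (step y)
      with down[of y] show ?case by (simp add: algebra_simps)
    qed simp
  qed
qed

text \<open>The chord is affine, so its sum over \<open>r\<close> parts depends only on their total
  \<open>n\<close>. It is therefore the same for \<open>x\<close> and for the balanced sizes, where
  it equals the sum of \<open>g\<close>.\<close>

lemma multipartite_le_turan_graph:
  fixes x :: "nat \<Rightarrow> nat"
  assumes k: "k \<ge> 1" and r: "r \<ge> k + 2" and n: "n \<ge> k * (k + 2)" and sum: "(\<Sum>i<r. x i) = n"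
  shows "(\<Sum>i<r. x i * ((n - x i) choose k)) \<le> e_phi k (turan_graph r n)"
proof -
  define g where "g x = real x * real ((n - x) choose k)" for x
  define q where "q = n div r"
  define D where "D = g (Suc q) - g q"
  define t where "t i = card (turan_part r n i)" for i
  have "1 * 1 \<le> k * (k + 2)" using k by (intro mult_mono) auto
  then have "n \<ge> 1" using n by linarith
  then have qn: "q < n" unfolding q_def using r k by (intro div_less_dividend) auto
  have "q * (k + 2) \<le> q * r" using r by (rule mult_le_mono2)
  also have "\<dots> \<le> n" unfolding q_def by simp
  finally have q: "(k + 2) * q \<le> n" by (simp add: mult.commute)
  \<comment> \<open>Both thresholds enter here: \<open>r \<ge> k + 2\<close> bounds
    \<open>(k + 2) * q\<close>, and \<open>n \<ge> k * (k + 2)\<close> pays for the additive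
    \<open>k\<close>.\<close>
  have "(k + 2) * ((k + 1) * q + k) = (k + 1) * ((k + 2) * q) + k * (k + 2)"
    by (simp add: algebra_simps)
  also have "\<dots> \<le> (k + 1) * n + n" using q n by (intro add_mono mult_le_mono2)
  also have "\<dots> = (k + 2) * n" by (simp add: algebra_simps)
  finally have qk: "(k + 1) * q + k \<le> n" by (subst (asm) mult_le_cancel1) simp
  have T: "e_phi k (turan_graph r n) = (\<Sum>i<r. t i * ((n - t i) choose k))"
    unfolding t_def using r by (intro e_phi_turan_graph) simp
  have t: "t i = q \<or> t i = Suc q" if "i < r" for i
    using card_turan_part[OF that] by (auto simp: t_def q_def)
  have "(\<Sum>i<r. t i) = card (\<Union>i<r. turan_part r n i)"
    unfolding t_def using turan_parts_partition(2)[of r n] r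
    by (intro card_UN_disjoint[symmetric]) (auto simp: turan_part_def)
  then have sum_t: "(\<Sum>i<r. t i) = n"
    using turan_parts_partition(1)[of r n] r by (simp add: turan_graph_def)
  have chord_sum: "(\<Sum>i<r. g q + (real (y i) - real q) * D) = real r * g q + (real n - real r * real q) * D"
    if "(\<Sum>i<r. y i) = n" for y
  proof -
    have "(\<Sum>i<r. real (y i)) = real n" using that by (metis of_nat_sum)
    then show ?thesis by (simp add: sum.distrib sum_subtractf flip: sum_distrib_right)
  qed
  have "(\<Sum>i<r. g (x i)) \<le> (\<Sum>i<r. g q + (real (x i) - real q) * D)"
  proof (rule sum_mono)
    fix i assume i: "i \<in> {..<r}"
    have "x i \<le> (\<Sum>i<r. x i)" using i by (intro member_le_sum) auto
    then show "g (x i) \<le> g q + (real (x i) - real q) * D"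
      using part_contribution_le_chord[OF k qn qk, of "x i"] sum by (simp add: g_def D_def)
  qed
  also have "\<dots> = (\<Sum>i<r. g q + (real (t i) - real q) * D)"
    using chord_sum[OF sum] chord_sum[OF sum_t] by simp
  also have "\<dots> = (\<Sum>i<r. g (t i))"
    by (intro sum.cong refl) (use t in \<open>force simp: D_def\<close>)
  finally have "real (\<Sum>i<r. x i * ((n - x i) choose k)) \<le> real (\<Sum>i<r. t i * ((n - t i) choose k))"
    by (simp add: g_def)
  then show ?thesis unfolding T by (simp only: of_nat_le_iff)
qed

lemma ex_phi_eq_turan_graph:
  assumes "k \<ge> 1" "r \<ge> k + 2" "n \<ge> k * (k + 2)"
  shows "ex_phi k n (complete_graph (r + 1)) = e_phi k (turan_graph r n)"
  unfolding ex_phi_def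
proof (rule Max_eqI[OF finite_e_phi_H_free])
  show "e_phi k (turan_graph r n) \<in> e_phi k ` H_free_graphs n (complete_graph (r + 1))"
    using turan_graph_in_H_free_graphs[of r n] assms(2) by (intro imageI) simp
  fix y assume "y \<in> e_phi k ` H_free_graphs n (complete_graph (r + 1))"
  then show "y \<le> e_phi k (turan_graph r n)"
    using e_phi_le_multipartite multipartite_le_turan_graph[OF assms] by (blast intro: le_trans)
qed

section \<open>The root of the Digamma equation\<close>

lemma Digamma_plus_of_nat:
  fixes z :: real
  assumes "z > 0"
  shows "Digamma (z + real k) = Digamma z + (\<Sum>i<k. 1 / (z + real i))"
proof (induction k)
  case (Suc k)
  have "Digamma (z + real k + 1) = Digamma (z + real k) + 1 / (z + real k)"
    using assms by (intro Digamma_plus1) (simp add: add_pos_nonneg less_imp_neq[symmetric])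
  then show ?case using Suc.IH by (simp add: algebra_simps)
qed simp

text \<open>The bound \<open>x \<le> real n - real k\<close> keeps the Digamma arguments positive,
  so the difference of the two values becomes a finite sum of positive terms.\<close>

lemma is_c1_iff:
  "is_c1 k n x \<longleftrightarrow> 0 \<le> x \<and> x \<le> real n - real k \<and>
     x * (\<Sum>i<k. 1 / (real n - x - real k + 1 + real i)) = 1"
proof (cases "x \<le> real n - real k")
  case True
  then have "Digamma (real n - x - real k + 1 + real k) =
      Digamma (real n - x - real k + 1) + (\<Sum>i<k. 1 / (real n - x - real k + 1 + real i))"
    by (intro Digamma_plus_of_nat) simp
  moreover have "real n - x - real k + 1 + real k = real n - x + 1" by simp
  ultimately show ?thesis by (auto simp: is_c1_def algebra_simps)
qed (simp add: is_c1_def)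

text \<open>Justifies the \<open>THE\<close> in \<open>c1\<close>. Existence is the intermediate
  value theorem; for uniqueness, \<open>S\<close> is nondecreasing and positive at a root, so
  \<open>x * S x\<close> is strictly larger at any later point.\<close>

lemma is_c1_unique:
  assumes "k \<ge> 1" "n \<ge> 2 * k"
  shows "\<exists>!x. is_c1 k n x"
proof -
  define S where "S x = (\<Sum>i<k. 1 / (real n - x - real k + 1 + real i))" for x
  have nk: "1 \<le> real n - real k" using assms by linarith
  have ex: "\<exists>x\<ge>0. x \<le> real n - real k \<and> x * S x = 1"
  proof (rule IVT')
    \<comment> \<open>At the right endpoint the summand for \<open>i = 0\<close> is already
      1.\<close>
    have "1 * 1 \<le> (real n - real k) * S (real n - real k)"
    proof (intro mult_mono)
      have "(\<Sum>i\<in>{0::nat}. 1 / (1 + real i)) \<le> (\<Sum>i<k. 1 / (1 + real i))"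
        using assms(1) by (intro sum_mono2) auto
      then show "1 \<le> S (real n - real k)" by (simp add: S_def)
    qed (use nk in auto)
    then show "1 \<le> (real n - real k) * S (real n - real k)" by simp
    show "continuous_on {0..real n - real k} (\<lambda>x. x * S x)"
      unfolding S_def by (intro continuous_intros) auto
  qed (use nk in auto)
  have uniq: "x = y" if "is_c1 k n x" "is_c1 k n y" "x \<le> y" for x y
  proof (rule ccontr)
    assume "x \<noteq> y"
    with that(3) have "x < y" by simp
    have xy: "0 \<le> x" "y \<le> real n - real k" "x * S x = 1" "y * S y = 1"
      using that by (auto simp: is_c1_iff S_def)
    have "S x \<le> S y"
      unfolding S_def using xy \<open>x < y\<close> by (intro sum_mono divide_left_mono) auto
    moreover have "0 < S x"
      using xy(1,3) by (metis mult_nonneg_nonpos not_le not_one_le_zero order_refl)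
    ultimately have "x * S x < y * S y"
      using xy(1) \<open>x < y\<close> by (intro mult_less_le_imp_less) auto
    then show False using xy by simp
  qed
  show ?thesis
  proof (rule ex_ex1I)
    show "\<exists>x. is_c1 k n x" using ex unfolding is_c1_iff S_def by blast
    show "x = y" if "is_c1 k n x" "is_c1 k n y" for x y
      using uniq[of x y] uniq[of y x] that by (cases "x \<le> y") auto
  qed
qed

text \<open>Each of the \<open>k\<close> summands lies between \<open>1 / (n - x)\<close> and
  \<open>1 / (n - x - k + 1)\<close>; clearing denominators in the two resulting estimates of
  \<open>x * S = 1\<close> gives the bounds.\<close>

lemma is_c1_bounds:
  assumes "is_c1 k n x"
  shows "(real k + 1) * x \<le> real n" "real n - real k + 1 \<le> (real k + 1) * x"
proof -
  define S where "S = (\<Sum>i<k. 1 / (real n - x - real k + 1 + real i))"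
  have x: "0 \<le> x" "x \<le> real n - real k" "x * S = 1" using assms by (auto simp: is_c1_iff S_def)
  have "x > 0" using x by (cases "x = 0") auto
  have "k \<noteq> 0" using x(3) by (cases "k = 0") (auto simp: S_def)
  then have nx: "real n - x > 0" using x by linarith
  have "(\<Sum>i<k. 1 / (real n - x)) \<le> S"
    unfolding S_def
  proof (rule sum_mono)
    fix i assume "i \<in> {..<k}"
    then have "real i + 1 \<le> real k" by auto
    then show "1 / (real n - x) \<le> 1 / (real n - x - real k + 1 + real i)"
      using x by (intro divide_left_mono) auto
  qed
  then have "x * (real k / (real n - x)) \<le> x * S" using x(1) by (intro mult_left_mono) auto
  then have "x * (real k / (real n - x)) \<le> 1" by (simp only: x(3))
  then show "(real k + 1) * x \<le> real n" using nx by (simp add: field_simps)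
  have "S \<le> (\<Sum>i<k. 1 / (real n - x - real k + 1))"
    unfolding S_def using x by (intro sum_mono divide_left_mono) auto
  then have "x * S \<le> x * (real k / (real n - x - real k + 1))"
    using x(1) by (intro mult_left_mono) auto
  then have "1 \<le> x * (real k / (real n - x - real k + 1))" by (simp only: x(3))
  then show "real n - real k + 1 \<le> (real k + 1) * x" using x(2) by (simp add: field_simps)
qed

text \<open>The sandwich holds from \<open>n = 2 * k\<close> on, where \<open>c1 k n\<close> is
  known to be the root; smaller \<open>n\<close> do not affect the limit.\<close>

lemma n_over_c1_tendsto:
  assumes "k \<ge> 1"
  shows "(\<lambda>n. real n / c1 k n) \<longlonglongrightarrow> real k + 1"
proof (rule tendsto_sandwich[of "\<lambda>_. real k + 1" _ _
      "\<lambda>n. (real k + 1) * (real n / (real n - real k + 1))"])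
  have ev: "\<forall>\<^sub>F n in sequentially. real k + 1 \<le> real n / c1 k n \<and>
      real n / c1 k n \<le> (real k + 1) * (real n / (real n - real k + 1))"
    using eventually_ge_at_top[of "2 * k"]
  proof eventually_elim
    case (elim n)
    then have "is_c1 k n (c1 k n)"
      unfolding c1_def by (rule theI'[OF is_c1_unique[OF assms]])
    note b = is_c1_bounds[OF this]
    have "0 < real n - real k + 1" using elim by linarith
    then have "0 < (real k + 1) * c1 k n" using b(2) by linarith
    then have "0 < c1 k n" by (simp add: zero_less_mult_iff)
    have "real n * (real n - real k + 1) \<le> real n * ((real k + 1) * c1 k n)"
      using b(2) by (intro mult_left_mono) auto
    then show ?case using b(1) \<open>0 < c1 k n\<close> \<open>0 < real n - real k + 1\<close>
      by (simp add: pos_le_divide_eq pos_divide_le_eq mult_ac)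
  qed
  show "\<forall>\<^sub>F n in sequentially. real k + 1 \<le> real n / c1 k n"
    using ev by eventually_elim simp
  show "\<forall>\<^sub>F n in sequentially. real n / c1 k n \<le> (real k + 1) * (real n / (real n - real k + 1))"
    using ev by eventually_elim simp
  show "(\<lambda>n. (real k + 1) * (real n / (real n - real k + 1))) \<longlonglongrightarrow> real k + 1"
    by real_asymp
qed (rule tendsto_const)

text \<open>Although \<open>c\<close> is bound by an existential quantifier, the second conjunct
  determines it, because limits of real sequences are unique.\<close>

theorem theorem2:
  fixes k :: nat
  assumes "k \<ge> 1"
  shows "\<exists>c :: real.
    (\<forall>n \<ge> 2 * k. \<exists>!x. is_c1 k n x) \<and>
    (\<exists>L. (\<lambda>n. real n / c1 k n) \<longlonglongrightarrow> L \<and> c = 1 + L) \<and>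
    (\<forall>r :: nat. real r \<ge> c \<longrightarrow>
      (\<forall>\<^sub>F n in sequentially.
        ex_phi k n (complete_graph (r + 1)) = e_phi k (turan_graph r n)))"
proof (rule exI[of _ "1 + (real k + 1)"], intro conjI allI impI)
  show "\<exists>L. (\<lambda>n. real n / c1 k n) \<longlonglongrightarrow> L \<and> 1 + (real k + 1) = 1 + L"
    using n_over_c1_tendsto[OF assms] by blast
  fix r :: nat
  assume "1 + (real k + 1) \<le> real r"
  then have r: "r \<ge> k + 2" by linarith
  show "\<forall>\<^sub>F n in sequentially.
      ex_phi k n (complete_graph (r + 1)) = e_phi k (turan_graph r n)"
    using eventually_ge_at_top[of "k * (k + 2)"]
    by eventually_elim (rule ex_phi_eq_turan_graph[OF assms r])
qed (use is_c1_unique[OF assms] in blast)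

end
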